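(* Let $X$ be a real normed linear space with unit sphere $S_X$, and let \begin{align*} DW_{B1}(X) & :=\sup\left\{\frac{(\lambda+\mu)\|u+v\|}{\|\lambda u+\mu v\|}: u,v\in S_X,\ u\perp_B v,\ \lambda>0,\ \mu>0\right\},\\ DW_{B2}(X) & := \sup\left\{\frac{\|u+v\|}{\|\gamma u+(1-\gamma) v\|}: u,v\in S_X,\ u\perp_B v,\ 0<\gamma<1\right\},\\ DW_{B3}(X) & := \sup\left\{\frac{\|u+v\|}{\inf_{0<\gamma<1}\|\gamma u+(1-\gamma) v\|}: u,v\in S_X,\ u\perp_B v \right\},\\ DW_{B4}(X) & := \sup\left\{\frac{2\|u+v\|}{\|u+v+\delta (u-v)\|}: u,v\in S_X,\ u\perp_B v,\ -1<\delta<1\right\},\\ DW_{B5}(X) & := \sup\left\{\frac{(1+t)\|u+v\|}{\|u+tv\|}: u,v\in S_X,\ u\perp_B v,\ t>0\right\}. \end{align*} Then $DW_B(X)=DW_{Bi}(X)$ for every $i=1,\ldots,5$.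
   Context: For a real normed linear space $X$, $S_X=\{x\in X:\|x\|=1\}$ denotes its unit sphere. For $x,y\in X$, $x\perp_B y$ means that $x$ is Birkhoff orthogonal to $y$, i.e. $\|x+\lambda y\|\geq\|x\|$ for all $\lambda\in\mathbb{R}$. The constant $DW_B(X)$ is $$DW_B(X)=\sup\left\{\frac{\|x\|+\|y\|}{\|x-y\|}\left\|\frac{x}{\|x\|}-\frac{y}{\|y\|}\right\|:\ x,y\in X\setminus\{0\},\ x\perp_B y\right\}.$$ *)

theory Defs
  imports "HOL-Analysis.Analysis"
begin

definition birkhoff_orthogonal :: "'a::real_normed_vector \<Rightarrow> 'a \<Rightarrow> bool"  (infix "\<bottom>\<^sub>B" 50)
  where "x \<bottom>\<^sub>B y \<longleftrightarrow> (\<forall>\<alpha>::real. norm (x + \<alpha> *\<^sub>R y) \<ge> norm x)"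

text \<open>
  The space is the whole type \<open>'a\<close>, passed as a type token. The suprema are taken in the
  extended reals, so that no boundedness or nonemptiness has to be presupposed: if the dimension
  of the space is at most one, there are no admissible pairs, and each supremum is \<open>-\<infinity>\<close>.
  Orthogonality makes every denominator below strictly positive.
\<close>

definition DW_B :: "'a::real_normed_vector itself \<Rightarrow> ereal"
  where "DW_B _ = Sup {ereal ((norm x + norm y) / norm (x - y) * norm (x /\<^sub>R norm x - y /\<^sub>R norm y))
    | x y :: 'a. x \<noteq> 0 \<and> y \<noteq> 0 \<and> x \<bottom>\<^sub>B y}"

definition DW_B1 :: "'a::real_normed_vector itself \<Rightarrow> ereal"
  where "DW_B1 _ = Sup {ereal ((\<alpha> + \<beta>) * norm (u + v) / norm (\<alpha> *\<^sub>R u + \<beta> *\<^sub>R v))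
    | (u :: 'a) v \<alpha> \<beta>. u \<in> sphere 0 1 \<and> v \<in> sphere 0 1 \<and> u \<bottom>\<^sub>B v \<and> \<alpha> > 0 \<and> \<beta> > 0}"

definition DW_B2 :: "'a::real_normed_vector itself \<Rightarrow> ereal"
  where "DW_B2 _ = Sup {ereal (norm (u + v) / norm (\<gamma> *\<^sub>R u + (1 - \<gamma>) *\<^sub>R v))
    | (u :: 'a) v \<gamma>. u \<in> sphere 0 1 \<and> v \<in> sphere 0 1 \<and> u \<bottom>\<^sub>B v \<and> 0 < \<gamma> \<and> \<gamma> < 1}"

definition DW_B3 :: "'a::real_normed_vector itself \<Rightarrow> ereal"
  where "DW_B3 _ = Sup {ereal (norm (u + v) / (INF \<gamma>\<in>{0<..<1}. norm (\<gamma> *\<^sub>R u + (1 - \<gamma>) *\<^sub>R v)))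
    | u v :: 'a. u \<in> sphere 0 1 \<and> v \<in> sphere 0 1 \<and> u \<bottom>\<^sub>B v}"

definition DW_B4 :: "'a::real_normed_vector itself \<Rightarrow> ereal"
  where "DW_B4 _ = Sup {ereal (2 * norm (u + v) / norm (u + v + \<delta> *\<^sub>R (u - v)))
    | (u :: 'a) v \<delta>. u \<in> sphere 0 1 \<and> v \<in> sphere 0 1 \<and> u \<bottom>\<^sub>B v \<and> - 1 < \<delta> \<and> \<delta> < 1}"

definition DW_B5 :: "'a::real_normed_vector itself \<Rightarrow> ereal"
  where "DW_B5 _ = Sup {ereal ((1 + t) * norm (u + v) / norm (u + t *\<^sub>R v))
    | (u :: 'a) v t. u \<in> sphere 0 1 \<and> v \<in> sphere 0 1 \<and> u \<bottom>\<^sub>B v \<and> t > 0}"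

end

theory Submission
  imports Defs
begin

text \<open>
  The quotient \<open>(\<alpha> + \<beta>) * norm (u + v) / norm (\<alpha> *\<^sub>R u + \<beta> *\<^sub>R v)\<close> is homogeneous of degree
  \<open>0\<close> in \<open>(\<alpha>, \<beta>)\<close>, and the normalisations \<open>\<alpha> + \<beta> = 1\<close>, \<open>\<alpha> + \<beta> = 2\<close>, \<open>\<alpha> = 1\<close> give the second,
  fourth and fifth constants. Birkhoff orthogonality is homogeneous as well, so \<open>x = \<alpha> *\<^sub>R u\<close> and
  \<open>y = - \<beta> *\<^sub>R v\<close> turn the first constant into the original one. For the third constant, the
  infimum is at least \<open>1/3\<close>: orthogonality bounds the norm below by \<open>\<gamma>\<close>, and the triangle
  inequality by \<open>1 - 2 * \<gamma>\<close>.
\<close>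

text \<open>For \<open>a \<noteq> 0\<close>, factoring \<open>a\<close> out turns the coefficient
  \<open>c\<close> into \<open>c * b / a\<close>, which is among the reals already quantified over.
  Both factors may be negative, and the passage between \<open>x - y\<close> and
  \<open>u + v\<close> relies on this.\<close>

lemma birkhoff_orthogonal_scaleR:
  fixes x y :: "'a::real_normed_vector"
  assumes "x \<bottom>\<^sub>B y"
  shows "(a *\<^sub>R x) \<bottom>\<^sub>B (b *\<^sub>R y)"
proof (cases "a = 0")
  case True
  then show ?thesis by (simp add: birkhoff_orthogonal_def)
next
  case False
  have "norm (a *\<^sub>R x) \<le> norm (a *\<^sub>R x + c *\<^sub>R (b *\<^sub>R y))" for c
  proof -
    have "\<bar>a\<bar> * norm x \<le> \<bar>a\<bar> * norm (x + (c * b / a) *\<^sub>R y)"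
      using assms unfolding birkhoff_orthogonal_def by (intro mult_left_mono) (blast, simp)
    also have "\<dots> = norm (a *\<^sub>R (x + (c * b / a) *\<^sub>R y))"
      by simp
    also have "a *\<^sub>R (x + (c * b / a) *\<^sub>R y) = a *\<^sub>R x + c *\<^sub>R (b *\<^sub>R y)"
      using False by (simp add: scaleR_add_right)
    finally show ?thesis by simp
  qed
  then show ?thesis by (simp add: birkhoff_orthogonal_def)
qed

text \<open>Scaled orthogonality, read off at coefficient \<open>1\<close>. It supplies lower bounds
  for denominators and for \<open>norm (u + v)\<close>.\<close>

lemma birkhoff_orthogonal_norm_combination_ge:
  fixes u v :: "'a::real_normed_vector"
  assumes "u \<bottom>\<^sub>B v"
  shows "\<bar>a\<bar> * norm u \<le> norm (a *\<^sub>R u + b *\<^sub>R v)"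
proof -
  have "norm (a *\<^sub>R u) \<le> norm (a *\<^sub>R u + 1 *\<^sub>R (b *\<^sub>R v))"
    using birkhoff_orthogonal_scaleR[OF assms, of a b] unfolding birkhoff_orthogonal_def by blast
  then show ?thesis by simp
qed

lemma norm_segment_ge_third:
  fixes u v :: "'a::real_normed_vector"
  assumes "norm u = 1" "norm v = 1" "u \<bottom>\<^sub>B v" "0 < \<gamma>" "\<gamma> < 1"
  shows "1/3 \<le> norm (\<gamma> *\<^sub>R u + (1 - \<gamma>) *\<^sub>R v)"
proof -
  have "\<gamma> \<le> norm (\<gamma> *\<^sub>R u + (1 - \<gamma>) *\<^sub>R v)"
    using birkhoff_orthogonal_norm_combination_ge[OF assms(3), of \<gamma> "1 - \<gamma>"] assms by simp
  moreover have "(1 - \<gamma>) - \<gamma> \<le> norm (\<gamma> *\<^sub>R u + (1 - \<gamma>) *\<^sub>R v)"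
    using norm_diff_ineq[of "(1 - \<gamma>) *\<^sub>R v" "\<gamma> *\<^sub>R u"] assms by (simp add: add.commute)
  \<comment> \<open>The bounds \<gamma> and 1 - 2 * \<gamma> cross at \<gamma> = 1/3, so the larger
    of them is never below 1/3.\<close>
  ultimately show ?thesis by linarith
qed

text \<open>The common form of the quotients in the first, second, fourth and fifth constants; these
  differ only in how the pair of coefficients is normalised.\<close>

definition DW_ratio :: "'a::real_normed_vector \<Rightarrow> 'a \<Rightarrow> real \<Rightarrow> real \<Rightarrow> real"
  where "DW_ratio u v \<alpha> \<beta> = (\<alpha> + \<beta>) * norm (u + v) / norm (\<alpha> *\<^sub>R u + \<beta> *\<^sub>R v)"

lemma DW_ratio_scale:
  assumes "c > 0"
  shows "DW_ratio u v (\<alpha> * c) (\<beta> * c) = DW_ratio u v \<alpha> \<beta>"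
proof -
  have "(\<alpha> * c) *\<^sub>R u + (\<beta> * c) *\<^sub>R v = c *\<^sub>R (\<alpha> *\<^sub>R u + \<beta> *\<^sub>R v)"
    by (simp add: scaleR_add_right mult.commute)
  then have "norm ((\<alpha> * c) *\<^sub>R u + (\<beta> * c) *\<^sub>R v) = c * norm (\<alpha> *\<^sub>R u + \<beta> *\<^sub>R v)"
    using assms by simp
  moreover have "\<alpha> * c + \<beta> * c = c * (\<alpha> + \<beta>)"
    by (simp add: algebra_simps)
  ultimately show ?thesis
    using assms by (simp add: DW_ratio_def mult.assoc)
qed

text \<open>Homogeneity allows any positive sum of coefficients to be prescribed. The sum
  \<open>s\<close> is a parameter because the second constant needs \<open>s = 1\<close> and the
  fourth \<open>s = 2\<close>.\<close>

lemma DW_ratio_sum_eq: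
  assumes "\<alpha> > 0" "\<beta> > 0" "s > 0"
  obtains \<gamma> where "0 < \<gamma>" "\<gamma> < s" "DW_ratio u v \<alpha> \<beta> = DW_ratio u v \<gamma> (s - \<gamma>)"
proof
  let ?c = "s / (\<alpha> + \<beta>)"
  show "0 < \<alpha> * ?c" "\<alpha> * ?c < s"
    using assms by (auto simp: field_simps)
  have "s - \<alpha> * ?c = \<beta> * ?c"
    using assms by (simp add: field_simps)
  then show "DW_ratio u v \<alpha> \<beta> = DW_ratio u v (\<alpha> * ?c) (s - \<alpha> * ?c)"
    using DW_ratio_scale[of ?c u v \<alpha> \<beta>] assms by simp
qed

lemma DW_ratio_convex:
  "DW_ratio u v \<gamma> (1 - \<gamma>) = norm (u + v) / norm (\<gamma> *\<^sub>R u + (1 - \<gamma>) *\<^sub>R v)"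
  by (simp add: DW_ratio_def)

lemma DW_ratio_midpoint:
  "DW_ratio u v (1 + \<delta>) (1 - \<delta>) = 2 * norm (u + v) / norm (u + v + \<delta> *\<^sub>R (u - v))"
proof -
  have "(1 + \<delta>) *\<^sub>R u + (1 - \<delta>) *\<^sub>R v = u + v + \<delta> *\<^sub>R (u - v)"
    by (simp add: algebra_simps)
  then show ?thesis
    by (simp add: DW_ratio_def)
qed

lemma DW_B1_eq:
  "DW_B1 TYPE('a::real_normed_vector) = Sup {ereal (DW_ratio u v \<alpha> \<beta>)
    | (u :: 'a) v \<alpha> \<beta>. norm u = 1 \<and> norm v = 1 \<and> u \<bottom>\<^sub>B v \<and> \<alpha> > 0 \<and> \<beta> > 0}"
  by (simp add: DW_B1_def DW_ratio_def)

lemma DW_B_eq_DW_B1: "DW_B TYPE('a::real_normed_vector) = DW_B1 TYPE('a)"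
  unfolding DW_B_def DW_B1_eq
proof (rule arg_cong[where f = Sup], intro set_eqI iffI; clarify)
  fix x y :: 'a
  assume "x \<noteq> 0" "y \<noteq> 0" "x \<bottom>\<^sub>B y"
  \<comment> \<open>The sign in \<open>v\<close> makes \<open>x - y\<close> a combination of
    \<open>u\<close> and \<open>v\<close> with positive coefficients, and the difference of the
    normalised vectors equal to \<open>u + v\<close>.\<close>
  define u v where "u = x /\<^sub>R norm x" and "v = (- 1 / norm y) *\<^sub>R y"
  have uv: "norm u = 1" "norm v = 1"
    "norm x *\<^sub>R u + norm y *\<^sub>R v = x - y" "u + v = x /\<^sub>R norm x - y /\<^sub>R norm y"
    using \<open>x \<noteq> 0\<close> \<open>y \<noteq> 0\<close> by (simp_all add: u_def v_def divide_inverse)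
  have orth: "u \<bottom>\<^sub>B v"
    unfolding u_def v_def using \<open>x \<bottom>\<^sub>B y\<close> by (rule birkhoff_orthogonal_scaleR)
  show "\<exists>(u :: 'a) v \<alpha> \<beta>. ereal ((norm x + norm y) / norm (x - y)
      * norm (x /\<^sub>R norm x - y /\<^sub>R norm y)) = ereal (DW_ratio u v \<alpha> \<beta>)
      \<and> norm u = 1 \<and> norm v = 1 \<and> u \<bottom>\<^sub>B v \<and> 0 < \<alpha> \<and> 0 < \<beta>"
    by (rule exI[of _ u], rule exI[of _ v],
       rule exI[of _ "norm x"], rule exI[of _ "norm y"],
       use \<open>x \<noteq> 0\<close> \<open>y \<noteq> 0\<close> uv orth in \<open>simp add: DW_ratio_def\<close>)
next
  fix u v :: 'a and \<alpha> \<beta> :: real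
  assume *: "norm u = 1" "norm v = 1" "u \<bottom>\<^sub>B v" "0 < \<alpha>" "0 < \<beta>"
  then have nz: "u \<noteq> 0" "v \<noteq> 0" by auto
  \<comment> \<open>The inverse substitution: these two vectors have norms \<alpha> and \<beta>, and
    their difference is the original denominator vector.\<close>
  have orth: "(\<alpha> *\<^sub>R u) \<bottom>\<^sub>B ((- \<beta>) *\<^sub>R v)"
    using \<open>u \<bottom>\<^sub>B v\<close> by (rule birkhoff_orthogonal_scaleR)
  show "\<exists>(x :: 'a) y. ereal (DW_ratio u v \<alpha> \<beta>) = ereal ((norm x + norm y) / norm (x - y)
      * norm (x /\<^sub>R norm x - y /\<^sub>R norm y)) \<and> x \<noteq> 0 \<and> y \<noteq> 0 \<and> x \<bottom>\<^sub>B y"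
    by (rule exI[of _ "\<alpha> *\<^sub>R u"], rule exI[of _ "(- \<beta>) *\<^sub>R v"],
       use * nz orth in \<open>simp add: DW_ratio_def\<close>)
qed

lemma DW_B1_eq_DW_B2: "DW_B1 TYPE('a::real_normed_vector) = DW_B2 TYPE('a)"
  unfolding DW_B1_eq DW_B2_def DW_ratio_convex[symmetric]
proof (rule arg_cong[where f = Sup], intro set_eqI iffI; clarify)
  fix u v :: 'a and \<alpha> \<beta> :: real
  assume *: "norm u = 1" "norm v = 1" "u \<bottom>\<^sub>B v" "0 < \<alpha>" "0 < \<beta>"
  obtain \<gamma> where gamma: "0 < \<gamma>" "\<gamma> < 1" "DW_ratio u v \<alpha> \<beta> = DW_ratio u v \<gamma> (1 - \<gamma>)"
    using DW_ratio_sum_eq[of \<alpha> \<beta> 1 u v] * by auto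
  show "\<exists>(u' :: 'a) v' \<gamma>. ereal (DW_ratio u v \<alpha> \<beta>) = ereal (DW_ratio u' v' \<gamma> (1 - \<gamma>))
      \<and> u' \<in> sphere 0 1 \<and> v' \<in> sphere 0 1 \<and> u' \<bottom>\<^sub>B v' \<and> 0 < \<gamma> \<and> \<gamma> < 1"
    by (rule exI[of _ u], rule exI[of _ v], rule exI[of _ \<gamma>], use * gamma in simp)
next
  fix u v :: 'a and \<gamma> :: real
  assume *: "u \<in> sphere 0 1" "v \<in> sphere 0 1" "u \<bottom>\<^sub>B v" "0 < \<gamma>" "\<gamma> < 1"
  show "\<exists>(u' :: 'a) v' \<alpha> \<beta>. ereal (DW_ratio u v \<gamma> (1 - \<gamma>)) = ereal (DW_ratio u' v' \<alpha> \<beta>)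
      \<and> norm u' = 1 \<and> norm v' = 1 \<and> u' \<bottom>\<^sub>B v' \<and> 0 < \<alpha> \<and> 0 < \<beta>"
    by (rule exI[of _ u], rule exI[of _ v], rule exI[of _ \<gamma>], rule exI[of _ "1 - \<gamma>"], use * in simp)
qed

lemma DW_B1_eq_DW_B4: "DW_B1 TYPE('a::real_normed_vector) = DW_B4 TYPE('a)"
  unfolding DW_B1_eq DW_B4_def DW_ratio_midpoint[symmetric]
proof (rule arg_cong[where f = Sup], intro set_eqI iffI; clarify)
  fix u v :: 'a and \<alpha> \<beta> :: real
  assume *: "norm u = 1" "norm v = 1" "u \<bottom>\<^sub>B v" "0 < \<alpha>" "0 < \<beta>"
  obtain \<gamma> where gamma: "0 < \<gamma>" "\<gamma> < 2" "DW_ratio u v \<alpha> \<beta> = DW_ratio u v \<gamma> (2 - \<gamma>)"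
    using DW_ratio_sum_eq[of \<alpha> \<beta> 2 u v] * by auto
  show "\<exists>(u' :: 'a) v' \<delta>. ereal (DW_ratio u v \<alpha> \<beta>) = ereal (DW_ratio u' v' (1 + \<delta>) (1 - \<delta>))
      \<and> u' \<in> sphere 0 1 \<and> v' \<in> sphere 0 1 \<and> u' \<bottom>\<^sub>B v' \<and> - 1 < \<delta> \<and> \<delta> < 1"
    \<comment> \<open>The witness solves \<gamma> = 1 + \<delta>, and then 2 - \<gamma> = 1 -
      \<delta>.\<close>
    by (rule exI[of _ u], rule exI[of _ v], rule exI[of _ "\<gamma> - 1"], use * gamma in simp)
next
  fix u v :: 'a and \<delta> :: real
  assume *: "u \<in> sphere 0 1" "v \<in> sphere 0 1" "u \<bottom>\<^sub>B v" "- 1 < \<delta>" "\<delta> < 1"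
  show "\<exists>(u' :: 'a) v' \<alpha> \<beta>. ereal (DW_ratio u v (1 + \<delta>) (1 - \<delta>)) = ereal (DW_ratio u' v' \<alpha> \<beta>)
      \<and> norm u' = 1 \<and> norm v' = 1 \<and> u' \<bottom>\<^sub>B v' \<and> 0 < \<alpha> \<and> 0 < \<beta>"
    by (rule exI[of _ u], rule exI[of _ v], rule exI[of _ "1 + \<delta>"], rule exI[of _ "1 - \<delta>"], use * in simp)
qed

lemma DW_B1_eq_DW_B5: "DW_B1 TYPE('a::real_normed_vector) = DW_B5 TYPE('a)"
proof -
  have ratio: "(1 + t) * norm (u + v) / norm (u + t *\<^sub>R v) = DW_ratio u v 1 t" for u v :: 'a and t
    by (simp add: DW_ratio_def)
  show ?thesis
    unfolding DW_B1_eq DW_B5_def ratio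
  proof (rule arg_cong[where f = Sup], intro set_eqI iffI; clarify)
    fix u v :: 'a and \<alpha> \<beta> :: real
    assume *: "norm u = 1" "norm v = 1" "u \<bottom>\<^sub>B v" "0 < \<alpha>" "0 < \<beta>"
    then have eq: "DW_ratio u v \<alpha> \<beta> = DW_ratio u v 1 (\<beta> / \<alpha>)"
      using DW_ratio_scale[of "1 / \<alpha>" u v \<alpha> \<beta>] by simp
    show "\<exists>(u' :: 'a) v' t. ereal (DW_ratio u v \<alpha> \<beta>) = ereal (DW_ratio u' v' 1 t)
        \<and> u' \<in> sphere 0 1 \<and> v' \<in> sphere 0 1 \<and> u' \<bottom>\<^sub>B v' \<and> 0 < t"
      by (rule exI[of _ u], rule exI[of _ v], rule exI[of _ "\<beta> / \<alpha>"], use * eq in simp)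
  next
    fix u v :: 'a and t :: real
    assume *: "u \<in> sphere 0 1" "v \<in> sphere 0 1" "u \<bottom>\<^sub>B v" "0 < t"
    show "\<exists>(u' :: 'a) v' \<alpha> \<beta>. ereal (DW_ratio u v 1 t) = ereal (DW_ratio u' v' \<alpha> \<beta>)
        \<and> norm u' = 1 \<and> norm v' = 1 \<and> u' \<bottom>\<^sub>B v' \<and> 0 < \<alpha> \<and> 0 < \<beta>"
      by (rule exI[of _ u], rule exI[of _ v], rule exI[of _ 1], rule exI[of _ t], use * in simp)
  qed
qed

text \<open>For a positive real bound \<open>s\<close>, the inequality
  \<open>N / f i \<le> s\<close> rearranges to \<open>N / s \<le> f i\<close>, which passes to the
  infimum and can be rearranged back. Infinite \<open>S\<close> is harmless: the upper value is
  trivial, and the lower one contradicts \<open>A\<close> being nonempty.\<close>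

lemma ereal_divide_INF_le:
  fixes f :: "'b \<Rightarrow> real"
  assumes "A \<noteq> {}" "0 < m" "0 < N" "\<And>i. i \<in> A \<Longrightarrow> m \<le> f i"
    and le: "\<And>i. i \<in> A \<Longrightarrow> ereal (N / f i) \<le> S"
  shows "ereal (N / (INF i\<in>A. f i)) \<le> S"
proof (cases S)
  case (real s)
  obtain j where "j \<in> A" using \<open>A \<noteq> {}\<close> by auto
  have pos: "0 < f i" if "i \<in> A" for i
    using assms(4)[OF that] \<open>0 < m\<close> by linarith
  have "0 < N / f j"
    using pos[OF \<open>j \<in> A\<close>] \<open>0 < N\<close> by simp
  with le[OF \<open>j \<in> A\<close>] real have "0 < s" by simp
  \<comment> \<open>This keeps the infimum positive, so the denominator in the goal can be
    cleared.\<close>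
  have "m \<le> (INF i\<in>A. f i)"
    using assms by (intro cINF_greatest) auto
  moreover have "N / s \<le> (INF i\<in>A. f i)"
  proof (rule cINF_greatest[OF \<open>A \<noteq> {}\<close>])
    fix i assume "i \<in> A"
    then show "N / s \<le> f i"
      using le[of i] real \<open>0 < s\<close> pos[of i] by (simp add: field_simps)
  qed
  ultimately show ?thesis
    using real \<open>0 < s\<close> \<open>0 < m\<close> by (simp add: field_simps)
next
  case MInf
  then show ?thesis using \<open>A \<noteq> {}\<close> le by auto
qed simp

text \<open>For fixed \<open>u\<close> and \<open>v\<close>, the quotient with the infimum is the
  least upper bound of the quotients over \<gamma>. The two inequalities use the two halves of this,
  and attainment of the infimum never enters.\<close>

lemma DW_B2_eq_DW_B3: "DW_B2 TYPE('a::real_normed_vector) = DW_B3 TYPE('a)"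
proof (rule antisym)
  show "DW_B2 TYPE('a) \<le> DW_B3 TYPE('a)"
    unfolding DW_B2_def
  proof (rule Sup_least, clarify)
    fix u v :: 'a and \<gamma> :: real
    let ?f = "\<lambda>\<gamma>. norm (\<gamma> *\<^sub>R u + (1 - \<gamma>) *\<^sub>R v)"
    assume *: "u \<in> sphere 0 1" "v \<in> sphere 0 1" "u \<bottom>\<^sub>B v" "0 < \<gamma>" "\<gamma> < 1"
    have "1/3 \<le> (INF \<gamma>\<in>{0<..<1}. ?f \<gamma>)"
      using * by (intro cINF_greatest norm_segment_ge_third) auto
    moreover have "(INF \<gamma>\<in>{0<..<1}. ?f \<gamma>) \<le> ?f \<gamma>"
      using * by (intro cINF_lower bdd_belowI2[of _ 0]) auto
    ultimately have "ereal (norm (u + v) / ?f \<gamma>)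
        \<le> ereal (norm (u + v) / (INF \<gamma>\<in>{0<..<1}. ?f \<gamma>))"
      by (auto intro!: divide_left_mono mult_pos_pos)
    also have "\<dots> \<le> DW_B3 TYPE('a)"
      unfolding DW_B3_def using * by (intro Sup_upper) blast
    finally show "ereal (norm (u + v) / ?f \<gamma>) \<le> DW_B3 TYPE('a)" .
  qed
  show "DW_B3 TYPE('a) \<le> DW_B2 TYPE('a)"
    unfolding DW_B3_def
  proof (rule Sup_least, clarify)
    fix u v :: 'a
    let ?f = "\<lambda>\<gamma>. norm (\<gamma> *\<^sub>R u + (1 - \<gamma>) *\<^sub>R v)"
    assume *: "u \<in> sphere 0 1" "v \<in> sphere 0 1" "u \<bottom>\<^sub>B v"
    show "ereal (norm (u + v) / (INF \<gamma>\<in>{0<..<1}. ?f \<gamma>)) \<le> DW_B2 TYPE('a)"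
    proof (rule ereal_divide_INF_le[where m = "1/3"])
      \<comment> \<open>Orthogonality with both coefficients \<open>1\<close> gives
        \<open>norm (u + v) \<ge> norm u = 1\<close>. Deleting the simp rule keeps the goal an
        inequality between norms.\<close>
      show "0 < norm (u + v)"
        using birkhoff_orthogonal_norm_combination_ge[OF *(3), of 1 1] *
        by (simp del: zero_less_norm_iff)
      show "1/3 \<le> ?f \<gamma>" if "\<gamma> \<in> {0<..<1}" for \<gamma>
        using * that by (intro norm_segment_ge_third) auto
      show "ereal (norm (u + v) / ?f \<gamma>) \<le> DW_B2 TYPE('a)" if "\<gamma> \<in> {0<..<1}" for \<gamma>
        unfolding DW_B2_def
        by (intro Sup_upper CollectI, rule exI[of _ u], rule exI[of _ v], rule exI[of _ \<gamma>],
            use * that in simp)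
    qed auto
  qed
qed

theorem proposition2:
  shows "DW_B TYPE('a::real_normed_vector) = DW_B1 TYPE('a)
    \<and> DW_B TYPE('a) = DW_B2 TYPE('a)
    \<and> DW_B TYPE('a) = DW_B3 TYPE('a)
    \<and> DW_B TYPE('a) = DW_B4 TYPE('a)
    \<and> DW_B TYPE('a) = DW_B5 TYPE('a)"
  using DW_B_eq_DW_B1[where 'a = 'a] DW_B1_eq_DW_B2[where 'a = 'a] DW_B2_eq_DW_B3[where 'a = 'a]
    DW_B1_eq_DW_B4[where 'a = 'a] DW_B1_eq_DW_B5[where 'a = 'a] by simp

end
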